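(* Let $S\neq\mathbb{N}$ be a numerical semigroup with multiplicity $m$, embedding dimension $\nu$ and Frobenius number $f(S)$. Write $f(S)+1=Lm+\rho$ with $L,\rho$ integers and $1\leq\rho\leq m$, and for each $k\ge 0$ let $n_k=|\{s\in S : km\le s\le (k+1)m-1,\ s<f(S)\}|$. Then $S$ satisfies Wilf's conjecture, i.e. $f(S)+1\leq n(S)\,\nu$, if and only if $$\sum_{k=0}^{L-1}(n_k\nu-m)+(n_L\nu-\rho)\geq 0 .$$
   Context: $\mathbb{N}$ denotes the natural numbers including $0$. A numerical semigroup is a submonoid $S$ of $(\mathbb{N},+)$ with finite complement in $\mathbb{N}$. The Frobenius number $f(S)$ is the largest integer not belonging to $S$. The multiplicity $m$ is the least positive element of $S$. The embedding dimension $\nu$ is the number of elements of the unique minimal system of generators of $S$. $n(S)=|\{s\in S : s<f(S)\}|$. Note $L=\lfloor f(S)/m\rfloor$. An empty sum is $0$. *)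

theory Defs
  imports Main "HOL.Hull"
begin

definition add_submonoid :: "nat set \<Rightarrow> bool" where
  "add_submonoid S \<longleftrightarrow> 0 \<in> S \<and> (\<forall>x\<in>S. \<forall>y\<in>S. x + y \<in> S)"

definition numerical_semigroup :: "nat set \<Rightarrow> bool" where
  "numerical_semigroup S \<longleftrightarrow> add_submonoid S \<and> finite (UNIV - S)"

definition multiplicity :: "nat set \<Rightarrow> nat" where
  "multiplicity S = (LEAST s. s \<in> S \<and> 0 < s)"

text \<open>The Frobenius number is the largest \<^emph>\<open>integer\<close> outside \<open>S\<close>, so it is \<open>-1\<close> for \<open>S = UNIV\<close>.\<close>

definition frobenius :: "nat set \<Rightarrow> int" where
  "frobenius S = (GREATEST z::int. z \<notin> int ` S)"

definition minimal_generating_system :: "nat set \<Rightarrow> nat set \<Rightarrow> bool" where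
  "minimal_generating_system S A \<longleftrightarrow>
     add_submonoid hull A = S \<and> (\<forall>B. B \<subset> A \<longrightarrow> add_submonoid hull B \<noteq> S)"

text \<open>
  The description \<open>THE A\<close> and the cardinality below are meaningful by
  \<open>ex1_minimal_generating_system\<close> and \<open>finite_minimal_generating_system\<close>.
\<close>

definition embedding_dimension :: "nat set \<Rightarrow> nat" where
  "embedding_dimension S = card (THE A. minimal_generating_system S A)"

definition num_below_frobenius :: "nat set \<Rightarrow> nat" where
  "num_below_frobenius S = card {s \<in> S. int s < frobenius S}"

definition num_in_block :: "nat set \<Rightarrow> nat \<Rightarrow> nat" where
  "num_in_block S k =
     card {s \<in> S. int k * int (multiplicity S) \<le> int s \<and>
                  int s \<le> (int k + 1) * int (multiplicity S) - 1 \<and>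
                  int s < frobenius S}"

definition satisfies_Wilf :: "nat set \<Rightarrow> bool" where
  "satisfies_Wilf S \<longleftrightarrow>
     frobenius S + 1 \<le> int (num_below_frobenius S) * int (embedding_dimension S)"

text \<open>The remaining facts show that the notions above are well defined.\<close>

lemma multiplicity_props:
  assumes "numerical_semigroup S"
  shows "multiplicity S \<in> S" "0 < multiplicity S"
    "s \<in> S \<Longrightarrow> 0 < s \<Longrightarrow> multiplicity S \<le> s"
proof -
  have "infinite S"
    using assms unfolding numerical_semigroup_def
    by (metis Diff_infinite_finite infinite_UNIV_nat)
  then obtain s0 where "s0 \<in> S" "0 < s0"
    by (metis finite_nat_set_iff_bounded_le not_le zero_le le_less_trans)
  then have "multiplicity S \<in> S \<and> 0 < multiplicity S"
    unfolding multiplicity_def by (intro LeastI[of "\<lambda>s. s \<in> S \<and> 0 < s" s0]) simp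
  then show "multiplicity S \<in> S" "0 < multiplicity S" by auto
  show "multiplicity S \<le> s" if "s \<in> S" "0 < s"
    using that unfolding multiplicity_def by (simp add: Least_le)
qed

lemma frobenius_props:
  assumes "numerical_semigroup S"
  shows "frobenius S \<notin> int ` S" "z \<notin> int ` S \<Longrightarrow> z \<le> frobenius S"
proof -
  let ?P = "\<lambda>z::int. z \<notin> int ` S"
  let ?G = "insert (-1) (int ` (UNIV - S))"
  have fin: "finite ?G"
    using assms unfolding numerical_semigroup_def by simp
  have "Max ?G \<in> ?G" using fin by (intro Max_in) auto
  then have P: "?P (Max ?G)" by auto
  have le: "z \<le> Max ?G" if "?P z" for z
  proof (cases "z < 0")
    case True
    have "-1 \<le> Max ?G" using fin by (intro Max_ge) auto
    then show ?thesis using True by linarith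
  next
    case False
    then have "z = int (nat z)" by simp
    then have "z \<in> ?G" using that by (metis Diff_iff UNIV_I imageI insertI2)
    then show ?thesis using fin by (intro Max_ge)
  qed
  have "frobenius S = Max ?G"
    unfolding frobenius_def using P le by (intro Greatest_equality) auto
  then show "frobenius S \<notin> int ` S" "z \<notin> int ` S \<Longrightarrow> z \<le> frobenius S"
    using P le by auto
qed

lemma add_submonoid_hull: "add_submonoid (add_submonoid hull A)"
  by (rule hull_in) (auto simp: add_submonoid_def)

lemma minimal_generating_system_iff:
  assumes "add_submonoid S"
  shows "minimal_generating_system S A \<longleftrightarrow>
           A = {s \<in> S. s \<noteq> 0 \<and> (\<forall>x\<in>S. \<forall>y\<in>S. s = x + y \<longrightarrow> x = 0 \<or> y = 0)}"
proof -
  define I where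
    "I = {s \<in> S. s \<noteq> 0 \<and> (\<forall>x\<in>S. \<forall>y\<in>S. s = x + y \<longrightarrow> x = 0 \<or> y = 0)}"
  have sub: "I \<subseteq> B" if B: "add_submonoid hull B = S" for B
  proof
    fix a assume a: "a \<in> I"
    show "a \<in> B"
    proof (rule ccontr)
      assume "a \<notin> B"
      then have "B \<subseteq> S - {a}" using B hull_subset[of B add_submonoid] by auto
      moreover have "add_submonoid (S - {a})"
        unfolding add_submonoid_def
      proof (intro conjI ballI)
        show "0 \<in> S - {a}"
          using assms a unfolding I_def add_submonoid_def by auto
        fix x y assume xy: "x \<in> S - {a}" "y \<in> S - {a}"
        then have "x + y \<in> S" using assms unfolding add_submonoid_def by blast
        moreover have "x + y \<noteq> a"
        proof
          assume "x + y = a"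
          then have "x = 0 \<or> y = 0" using a xy unfolding I_def by blast
          then show False using xy \<open>x + y = a\<close> by auto
        qed
        ultimately show "x + y \<in> S - {a}" by simp
      qed
      ultimately have "add_submonoid hull B \<subseteq> S - {a}" by (rule hull_minimal)
      then show False using B a unfolding I_def by auto
    qed
  qed
  have gen: "add_submonoid hull I = S"
  proof
    show "add_submonoid hull I \<subseteq> S"
      by (rule hull_minimal) (use assms in \<open>auto simp: I_def\<close>)
    have "s \<in> S \<longrightarrow> s \<in> add_submonoid hull I" for s
    proof (induction s rule: less_induct)
      case (less s)
      consider "s \<in> I" | "s = 0" | "s \<notin> S"
        | x y where "x \<in> S" "y \<in> S" "s = x + y" "x \<noteq> 0" "y \<noteq> 0"
        unfolding I_def by blast
      then show ?case
      proof cases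
        case 1
        then show ?thesis by (simp add: hull_inc)
      next
        case 2
        then show ?thesis
          using add_submonoid_hull[of I] unfolding add_submonoid_def[of "_ hull _"] by simp
      next
        case 4
        then have "x \<in> add_submonoid hull I" "y \<in> add_submonoid hull I"
          using less.IH[of x] less.IH[of y] by auto
        then show ?thesis
          using 4 add_submonoid_hull[of I] unfolding add_submonoid_def[of "_ hull _"] by simp
      qed simp
    qed
    then show "S \<subseteq> add_submonoid hull I" by auto
  qed
  show ?thesis
    unfolding I_def[symmetric]
  proof
    assume A: "minimal_generating_system S A"
    then have "I \<subseteq> A" using sub by (simp add: minimal_generating_system_def)
    then show "A = I"
      using A gen unfolding minimal_generating_system_def by (metis psubsetI)
  next
    assume "A = I"
    then show "minimal_generating_system S A"
      using sub gen unfolding minimal_generating_system_def by (metis leD)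
  qed
qed

lemma ex1_minimal_generating_system:
  assumes "numerical_semigroup S"
  shows "\<exists>!A. minimal_generating_system S A"
  using assms minimal_generating_system_iff unfolding numerical_semigroup_def by auto

lemma finite_minimal_generating_system:
  assumes S: "numerical_semigroup S" and A: "minimal_generating_system S A"
  shows "finite A"
proof -
  let ?m = "multiplicity S"
  have sub: "A \<subseteq> {0..?m} \<union> (\<lambda>x. x + ?m) ` (UNIV - S)"
  proof
    fix a assume "a \<in> A"
    then have a: "a \<noteq> 0" "\<forall>x\<in>S. \<forall>y\<in>S. a = x + y \<longrightarrow> x = 0 \<or> y = 0"
      using A S minimal_generating_system_iff unfolding numerical_semigroup_def by auto
    show "a \<in> {0..?m} \<union> (\<lambda>x. x + ?m) ` (UNIV - S)"
    proof (cases "a \<le> ?m")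
      case False
      then have e: "a = (a - ?m) + ?m" "a - ?m \<noteq> 0" by auto
      then have "a - ?m \<notin> S"
        using a(2)[rule_format, of "a - ?m" ?m] multiplicity_props(1,2)[OF S] by auto
      then show ?thesis using e by blast
    qed simp
  qed
  show ?thesis
    by (rule finite_subset[OF sub]) (use S in \<open>auto simp: numerical_semigroup_def\<close>)
qed

end

theory Submission
  imports Defs
begin

text \<open>
  The expression compared with \<open>0\<close> is \<open>n(S) \<nu> - (f(S) + 1)\<close> regrouped by blocks of length \<open>m\<close>.
  The elements of \<open>S\<close> below \<open>f(S)\<close> are sorted by their quotient on division by \<open>m\<close>
  (\<open>card_eq_sum_card_blocks\<close>); since \<open>f(S) < (L + 1) m\<close>, only the quotients \<open>0, \<dots>, L\<close>
  occur, so \<open>n(S)\<close> is the sum of the \<open>n\<^sub>k\<close> with \<open>k \<le> L\<close>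
  (\<open>num_below_frobenius_eq_sum_blocks\<close>). On the other side \<open>f(S) + 1 = L m + \<rho>\<close> charges
  \<open>m\<close> to each of the first \<open>L\<close> blocks and \<open>\<rho>\<close> to the last one. The hypothesis
  \<open>S \<noteq> UNIV\<close> makes \<open>f(S)\<close> nonnegative, hence \<open>L \<ge> 0\<close>, so that the sum up to
  \<open>L - 1\<close> does run over \<open>L\<close> blocks.
\<close>

lemma card_eq_sum_card_blocks:
  fixes A :: "nat set" and m M :: nat
  assumes "0 < m" and "A \<subseteq> {..<M * m}"
  shows "card A = (\<Sum>k<M. card {s \<in> A. k * m \<le> s \<and> s < (k + 1) * m})"
proof -
  have block: "{s \<in> A. k * m \<le> s \<and> s < (k + 1) * m} = {s \<in> A. s div m = k}" for k
    using assms(1) by (auto simp: div_nat_eqI mult.commute dividend_less_times_div)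
  have "finite A"
    using assms(2) finite_subset by blast
  moreover have "(\<lambda>s. s div m) ` A \<subseteq> {..<M}"
    using assms by (auto simp: less_mult_imp_div_less)
  ultimately have "(\<Sum>k<M. \<Sum>s | s \<in> A \<and> s div m = k. 1) = (\<Sum>s\<in>A. 1::nat)"
    by (intro sum.group) auto
  then show ?thesis
    unfolding block by simp
qed

lemma num_below_frobenius_eq_sum_blocks:
  assumes S: "numerical_semigroup S"
    and M: "frobenius S \<le> int M * int (multiplicity S)"
  shows "num_below_frobenius S = (\<Sum>k<M. num_in_block S k)"
proof -
  let ?m = "multiplicity S" and ?A = "{s \<in> S. int s < frobenius S}"
  have "s < M * ?m" if "s \<in> ?A" for s
  proof -
    have "int s < int (M * ?m)"
      using that M by simp
    then show ?thesis
      by (simp only: of_nat_less_iff)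
  qed
  then have "card ?A = (\<Sum>k<M. card {s \<in> ?A. k * ?m \<le> s \<and> s < (k + 1) * ?m})"
    using multiplicity_props(2)[OF S] by (intro card_eq_sum_card_blocks) auto
  moreover have "{s \<in> ?A. k * ?m \<le> s \<and> s < (k + 1) * ?m} =
      {s \<in> S. int k * int ?m \<le> int s \<and> int s \<le> (int k + 1) * int ?m - 1 \<and>
              int s < frobenius S}" for k
  proof -
    have "k * ?m \<le> s \<longleftrightarrow> int k * int ?m \<le> int s" for s
      by (metis of_nat_le_iff of_nat_mult)
    moreover have "s < (k + 1) * ?m \<longleftrightarrow> int s \<le> (int k + 1) * int ?m - 1" for s
    proof -
      have "s < (k + 1) * ?m \<longleftrightarrow> int s < int ((k + 1) * ?m)"
        by (simp only: of_nat_less_iff)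
      then show ?thesis
        by (auto simp: algebra_simps)
    qed
    ultimately show ?thesis
      by auto
  qed
  ultimately show ?thesis
    by (simp add: num_below_frobenius_def num_in_block_def)
qed

lemma frobenius_nonneg:
  assumes "numerical_semigroup S" and "S \<noteq> UNIV"
  shows "0 \<le> frobenius S"
proof -
  obtain x where "x \<notin> S"
    using assms(2) by blast
  then have "int x \<le> frobenius S"
    by (intro frobenius_props(2)[OF assms(1)]) auto
  then show ?thesis
    by simp
qed

lemma sum_int_interval_eq_sum_nat:
  fixes g :: "nat \<Rightarrow> 'a::comm_monoid_add"
  shows "(\<Sum>k = 0..int l - 1. g (nat k)) = (\<Sum>k<l. g k)"
  by (rule sum.reindex_bij_witness[of _ int nat]) auto

theorem proposition10:
  fixes S :: "nat set" and L \<rho> :: int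
  assumes "numerical_semigroup S"
    and "S \<noteq> UNIV"
    and "frobenius S + 1 = L * int (multiplicity S) + \<rho>"
    and "1 \<le> \<rho>"
    and "\<rho> \<le> int (multiplicity S)"
  shows "satisfies_Wilf S \<longleftrightarrow>
    (\<Sum>k = 0..L - 1. int (num_in_block S (nat k)) * int (embedding_dimension S)
                        - int (multiplicity S))
      + (int (num_in_block S (nat L)) * int (embedding_dimension S) - \<rho>) \<ge> 0"
proof -
  let ?m = "int (multiplicity S)" and ?\<nu> = "int (embedding_dimension S)"
  let ?n = "\<lambda>k. int (num_in_block S k)"
  \<comment> \<open>\<open>L < 0\<close> would give \<open>f(S) + 1 = L m + \<rho> \<le> 0\<close>, because \<open>\<rho> \<le> m\<close>\<close>
  have "0 < (L + 1) * ?m"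
    using frobenius_nonneg[OF assms(1,2)] assms(3,5) by (simp add: algebra_simps)
  then have "0 \<le> L"
    by (simp add: zero_less_mult_iff)
  then obtain l where l: "L = int l"
    using nonneg_int_cases by blast
  have "frobenius S \<le> int (Suc l) * ?m"
    using assms(3,5) l by (simp add: algebra_simps)
  then have total: "int (num_below_frobenius S) = (\<Sum>k<l. ?n k) + ?n l"
    using num_below_frobenius_eq_sum_blocks[OF assms(1), of "Suc l"] by simp
  have "(\<Sum>k = 0..L - 1. ?n (nat k) * ?\<nu> - ?m) + (?n (nat L) * ?\<nu> - \<rho>)
      = (\<Sum>k<l. ?n k * ?\<nu> - ?m) + (?n l * ?\<nu> - \<rho>)"
    unfolding l by (simp add: sum_int_interval_eq_sum_nat[where g = "\<lambda>k. ?n k * ?\<nu> - ?m"])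
  also have "\<dots> = int (num_below_frobenius S) * ?\<nu> - (frobenius S + 1)"
    unfolding total assms(3) l
    by (simp add: sum_subtractf sum_distrib_left algebra_simps)
  finally show ?thesis
    unfolding satisfies_Wilf_def by simp
qed

end
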